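(* Let $F(\mathbf t)$, $\mathbf t=(t_1,t_3,t_5,\dots)$, be a $\tau$-function of the dispersionless BKP hierarchy, and let $z_1,z_2,z_3$ be points with $|z_i|>1$ and $z_i\ne\pm z_j$ for $i\neq j$. Put $\mathcal D_i=\mathcal D(z_i)$ and $c_i=\dfrac{z_j+z_k}{z_j-z_k}$ for $(i,j,k)$ a cyclic permutation of $(1,2,3)$. Then $F$ satisfies the addition formula $$1+c_2c_3\,e^{-(\mathcal D_3\mathcal D_1+\mathcal D_1\mathcal D_2)F}+c_1c_3\,e^{-(\mathcal D_2\mathcal D_3+\mathcal D_1\mathcal D_2)F}+c_2c_1\,e^{-(\mathcal D_3\mathcal D_1+\mathcal D_2\mathcal D_3)F}=0 .$$
   Context: The B-type quasiclassical vertex operator is $\mathcal D(z)=2\sum_{n=0}^\infty\frac{z^{-(2n+1)}}{2n+1}\frac{\partial}{\partial t_{2n+1}}$, $|z|>1$. A $\tau$-function of the dispersionless BKP hierarchy is a smooth function $F(\mathbf t)$ such that, with $p(z)=z-\partial_{t_1}\mathcal D(z)F$, $$\frac{p(z_1)-p(z_2)}{p(z_1)+p(z_2)}=\frac{z_1-z_2}{z_1+z_2}\,e^{\mathcal D(z_1)\mathcal D(z_2)F}$$ for all $|z_1|,|z_2|>1$ with $z_1\neq -z_2$ (in particular $p(z_1)+p(z_2)\ne0$). All series obtained by applying vertex operators are assumed to converge. *)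

theory Defs
  imports "HOL-Analysis.Analysis"
begin

text \<open>
  The times \<open>t\<^sub>1, t\<^sub>3, t\<^sub>5, \<dots>\<close> are real; coordinate \<open>n\<close> of a vector of times is \<open>t\<^sub>2\<^sub>n\<^sub>+\<^sub>1\<close>, so that
  \<open>\<partial>/\<partial>t\<^sub>1\<close> is \<open>time_deriv 0\<close>.
\<close>

type_synonym times = "nat \<Rightarrow> real"

definition time_deriv :: "nat \<Rightarrow> (times \<Rightarrow> complex) \<Rightarrow> times \<Rightarrow> complex" where
  "time_deriv n F t = vector_derivative (\<lambda>s. F (t(n := s))) (at (t n))"

definition time_differentiable_on :: "times set \<Rightarrow> (times \<Rightarrow> complex) \<Rightarrow> bool" where
  "time_differentiable_on T F \<longleftrightarrow>
     (\<forall>t\<in>T. \<forall>n. (\<lambda>s. F (t(n := s))) differentiable (at (t n)))"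

text \<open>
  Openness and smoothness in infinitely many variables refer to each finite set of variables
  with the remaining ones frozen: on \<open>time_slice N t\<close>, a copy of \<open>\<real>\<^sup>N\<close>, the product topology
  is the Euclidean one. Thus no topology on the space of all times has to be singled out:
  domains that are open in the product topology or in a sequence-space norm are covered.
\<close>

definition time_slice :: "nat \<Rightarrow> times \<Rightarrow> times set" where
  "time_slice N t = {s. \<forall>k\<ge>N. s k = t k}"

definition open_times :: "times set \<Rightarrow> bool" where
  "open_times T \<longleftrightarrow>
     (\<forall>t N. openin (top_of_set (time_slice N t)) (T \<inter> time_slice N t))"

definition smooth_times_on :: "times set \<Rightarrow> (times \<Rightarrow> complex) \<Rightarrow> bool" where
  "smooth_times_on T F \<longleftrightarrow>
     (\<forall>ns. time_differentiable_on T (foldr time_deriv ns F) \<and>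
           (\<forall>t N. continuous_on (T \<inter> time_slice N t) (foldr time_deriv ns F)))"

definition vertex_term ::
  "complex \<Rightarrow> (times \<Rightarrow> complex) \<Rightarrow> times \<Rightarrow> nat \<Rightarrow> complex" where
  "vertex_term z F t n =
     z powi (- (2 * int n + 1)) / of_nat (2 * n + 1) * time_deriv n F t"

definition vertex_op :: "complex \<Rightarrow> (times \<Rightarrow> complex) \<Rightarrow> times \<Rightarrow> complex" where
  "vertex_op z F t = 2 * (\<Sum>n. vertex_term z F t n)"

definition vertex_applicable :: "times set \<Rightarrow> complex \<Rightarrow> (times \<Rightarrow> complex) \<Rightarrow> bool" where
  "vertex_applicable T z F \<longleftrightarrow>
     time_differentiable_on T F \<and> (\<forall>t\<in>T. summable (vertex_term z F t))"

definition dBKP_p :: "(times \<Rightarrow> complex) \<Rightarrow> times \<Rightarrow> complex \<Rightarrow> complex" where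
  "dBKP_p F t z = z - time_deriv 0 (vertex_op z F) t"

text \<open>
  Products of vertex operators are compositions of operators. Applicability of \<open>vertex_op w\<close>
  to \<open>vertex_op z F\<close> includes the existence of \<open>\<partial>/\<partial>t\<^sub>1 (vertex_op z F)\<close>.
\<close>

definition dBKP_tau_on :: "times set \<Rightarrow> (times \<Rightarrow> complex) \<Rightarrow> bool" where
  "dBKP_tau_on T F \<longleftrightarrow>
     open_times T \<and> smooth_times_on T F \<and>
     (\<forall>z. norm z > 1 \<longrightarrow> vertex_applicable T z F) \<and>
     (\<forall>w z. norm w > 1 \<longrightarrow> norm z > 1 \<longrightarrow> vertex_applicable T w (vertex_op z F)) \<and>
     (\<forall>t\<in>T. \<forall>z1 z2. norm z1 > 1 \<longrightarrow> norm z2 > 1 \<longrightarrow> z1 \<noteq> - z2 \<longrightarrow>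
        dBKP_p F t z1 + dBKP_p F t z2 \<noteq> 0 \<and>
        (dBKP_p F t z1 - dBKP_p F t z2) / (dBKP_p F t z1 + dBKP_p F t z2) =
          (z1 - z2) / (z1 + z2) * exp (vertex_op z1 (vertex_op z2 F) t))"

end

theory Submission
  imports Defs
begin

text \<open>
  For each pair, the dBKP equation inverted reads
  \<open>c\<^sub>k exp (-D\<^sub>i D\<^sub>j F) = (p\<^sub>i + p\<^sub>j) / (p\<^sub>i - p\<^sub>j)\<close>, so the addition formula is a rational identity
  in three variables \<open>p\<^sub>i = p(z\<^sub>i)\<close>.
\<close>

text \<open>Since \<open>a + 1 = 2 * y / (y - z)\<close> and \<open>a - 1 = 2 * z / (y - z)\<close>,
  and cyclically, \<open>(a + 1) * (b + 1) * (c + 1)\<close> and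
  \<open>(a - 1) * (b - 1) * (c - 1)\<close> agree; their difference is twice the claim. Clearing
  denominators instead also covers characteristic 2.\<close>

lemma cyclic_ratio_identity:
  fixes x y z :: "'a::field"
  assumes "x \<noteq> y" "y \<noteq> z" "z \<noteq> x"
  defines "a \<equiv> (y + z) / (y - z)" and "b \<equiv> (z + x) / (z - x)" and "c \<equiv> (x + y) / (x - y)"
  shows "1 + b * c + a * c + b * a = 0"
proof -
  have "x - y \<noteq> 0" "y - z \<noteq> 0" "z - x \<noteq> 0"
    using assms(1-3) by auto
  then have "1 + b * c + a * c + b * a =
    ((x - y) * (y - z) * (z - x) + (z + x) * (x + y) * (y - z)
      + (y + z) * (x + y) * (z - x) + (z + x) * (y + z) * (x - y))
      / ((x - y) * (y - z) * (z - x))"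
    unfolding a_def b_def c_def by (simp add: divide_simps) (simp add: algebra_simps)
  also have "\<dots> = 0"
    by (simp add: algebra_simps)
  finally show ?thesis .
qed

lemma dBKP_tau_on_inverted:
  assumes "dBKP_tau_on T F" "t \<in> T" "norm z > 1" "norm w > 1" "z \<noteq> w" "z \<noteq> - w"
  shows "dBKP_p F t z \<noteq> dBKP_p F t w"
    and "(z + w) / (z - w) * exp (- vertex_op z (vertex_op w F) t) =
      (dBKP_p F t z + dBKP_p F t w) / (dBKP_p F t z - dBKP_p F t w)"
proof -
  let ?p = "dBKP_p F t z" and ?q = "dBKP_p F t w"
  have eq: "(?p - ?q) / (?p + ?q) =
      (z - w) / (z + w) * exp (vertex_op z (vertex_op w F) t)"
    using assms unfolding dBKP_tau_on_def by blast
  have "z + w \<noteq> 0"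
    using assms(6) by (simp add: eq_neg_iff_add_eq_0)
  \<comment> \<open>Equal values would make the left side of \<open>eq\<close> vanish, while the
    right side is a product of nonzero factors.\<close>
  then show "?p \<noteq> ?q"
    using eq assms(5) by auto
  have "(?p + ?q) / (?p - ?q) = inverse ((?p - ?q) / (?p + ?q))"
    by simp
  also have "\<dots> = (z + w) / (z - w) * exp (- vertex_op z (vertex_op w F) t)"
    unfolding eq by (simp add: exp_minus field_simps)
  finally show "(z + w) / (z - w) * exp (- vertex_op z (vertex_op w F) t) =
      (?p + ?q) / (?p - ?q)" ..
qed

theorem mainTheorem3:
  fixes F :: "times \<Rightarrow> complex" and T :: "times set" and t :: times
    and z1 z2 z3 :: complex
  assumes "dBKP_tau_on T F" and "t \<in> T"
    and "norm z1 > 1" and "norm z2 > 1" and "norm z3 > 1"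
    and "z1 \<noteq> z2" and "z1 \<noteq> - z2"
    and "z2 \<noteq> z3" and "z2 \<noteq> - z3"
    and "z3 \<noteq> z1" and "z3 \<noteq> - z1"
  shows "let D1 = vertex_op z1; D2 = vertex_op z2; D3 = vertex_op z3;
             c1 = (z2 + z3) / (z2 - z3);
             c2 = (z3 + z1) / (z3 - z1);
             c3 = (z1 + z2) / (z1 - z2)
         in 1 + c2 * c3 * exp (- (D3 (D1 F) t + D1 (D2 F) t))
              + c1 * c3 * exp (- (D2 (D3 F) t + D1 (D2 F) t))
              + c2 * c1 * exp (- (D3 (D1 F) t + D2 (D3 F) t)) = 0"
proof -
  note inv = dBKP_tau_on_inverted[OF assms(1,2)]
  \<comment> \<open>The cyclic order of the pairs matches both the order of composition and the
    signs of the denominators in the goal, so these equations rewrite it literally.\<close>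
  note eqs = inv(2)[OF assms(3,4,6,7)] inv(2)[OF assms(4,5,8,9)] inv(2)[OF assms(5,3,10,11)]
  \<comment> \<open>Each exponential is paired with the coefficient of its own two points, which
    produces the left sides of \<open>eqs\<close>.\<close>
  have "c2 * c3 * exp (- (d31 + d12)) = (c2 * exp (- d31)) * (c3 * exp (- d12))"
    "c1 * c3 * exp (- (d23 + d12)) = (c1 * exp (- d23)) * (c3 * exp (- d12))"
    "c2 * c1 * exp (- (d31 + d23)) = (c2 * exp (- d31)) * (c1 * exp (- d23))"
    for c1 c2 c3 d12 d23 d31 :: complex
    by (simp_all add: exp_minus exp_diff field_simps)
  note split = this
  show ?thesis
    unfolding Let_def split eqs
    by (rule cyclic_ratio_identity[OF inv(1)[OF assms(3,4,6,7)] inv(1)[OF assms(4,5,8,9)]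
          inv(1)[OF assms(5,3,10,11)]])
qed

end
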